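(* Let $\bm{\gamma}=(\gamma_0,\gamma_1,\ldots)\in\{0,1\}^{\infty}$ and let $K\in\mathbb{Z}_{\geq0}$ be such that $\gamma_i=\gamma_{i\oplus j}$ for all $i,j\in\mathbb{Z}_{\ge0}$ with $j<2^K$. Then for all $a,b\in\mathbb{Z}_{\geq0}$ with $b<2^K$, ${\ast}^{\bm{\gamma}}a+{\ast}^{\bm{0}}b={\ast}^{\bm{\gamma}}(a\oplus b)$.
   Context: Let $\mathcal{B}=\{0,1\}$. Define $\mathbb{I}_0=\{\emptyset\}\times\mathcal{B}$ and $\mathbb{I}_n=2^{\mathbb{I}_{n-1}}\times\mathcal{B}$ for $n\ge1$; a game with activeness is an element of $\mathbb{I}=\bigcup_{n\ge0}\mathbb{I}_n$. A pair $(G,g)$ is written $G^g$; elements of $G$ are its options, $g=1$ meaning active. The outcome $o$ is defined recursively: $o(G^g)=\mathscr{N}$ if $g=1$ and some option has outcome $\mathscr{P}$, and $o(G^g)=\mathscr{P}$ otherwise. The sum is $G^g+H^h=(\{G'^{g'}+H^h:G'^{g'}\in G^g\}\cup\{G^g+H'^{h'}:H'^{h'}\in H^h\})^{\max\{g,h\}}$. $G^g=H^h$ means $o(G^g+X^x)=o(H^h+X^x)$ for all games $X^x$. For $\bm{\gamma}\in\mathcal{B}^\infty$, ${\ast}^{\bm{\gamma}}i=\{{\ast}^{\bm{\gamma}}j:0\le j<i\}^{\gamma_i}$ recursively; $\bm{0}=(0,0,\ldots)$. $\oplus$ denotes bitwise XOR (nim-sum). *)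

theory Defs
  imports "HOL-Library.FSet"
begin

unbundle bit_operations_syntax

text \<open>Every level of the hierarchy of games with activeness is finite (\<open>finite_game_level\<close>), so the
  games are exactly the hereditarily finite sets in which each set carries a Boolean label (True for
  active); \<open>Union_game_level\<close> shows that the levels exhaust the type. HOL equality on this type is identity of games, not the
  equality \<open>=\<^sub>G\<close> defined through outcomes.\<close>

datatype game = Game (opts: "game fset") (active: bool)

fun game_level :: "nat \<Rightarrow> game set" where
  "game_level 0 = {Game {||} g | g. True}"
| "game_level (Suc n) = {Game G g | G g. fset G \<subseteq> game_level n}"

lemma game_level_Suc_mono: "game_level n \<subseteq> game_level (Suc n)"
proof (induction n)
  case (Suc n)
  then show ?case by fastforce
qed auto

lemma game_level_mono: "m \<le> n \<Longrightarrow> game_level m \<subseteq> game_level n"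
  using lift_Suc_mono_le[of game_level, OF game_level_Suc_mono] by blast

lemma finite_game_level: "finite (game_level n)"
proof (induction n)
  case 0
  have "game_level 0 = Game {||} ` UNIV" by auto
  then show ?case by simp
next
  case (Suc n)
  have "game_level (Suc n) \<subseteq>
    (\<lambda>(A, g). Game (Abs_fset A) g) ` (Pow (game_level n) \<times> UNIV)"
  proof
    fix x assume "x \<in> game_level (Suc n)"
    then obtain G g where "x = Game G g" "fset G \<subseteq> game_level n" by auto
    then show "x \<in> (\<lambda>(A, g). Game (Abs_fset A) g) ` (Pow (game_level n) \<times> UNIV)"
      by (intro image_eqI[of _ _ "(fset G, g)"]) (auto simp: fset_inverse)
  qed
  moreover have "finite ((\<lambda>(A, g). Game (Abs_fset A) g) `
    (Pow (game_level n) \<times> (UNIV :: bool set)))"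
    using Suc by simp
  ultimately show ?case by (rule finite_subset)
qed

lemma Union_game_level: "(\<Union>n. game_level n) = UNIV"
proof -
  have "\<exists>n. x \<in> game_level n" for x
  proof (induction x)
    case (Game G g)
    then obtain f where f: "\<And>y. y \<in> fset G \<Longrightarrow> y \<in> game_level (f y)" by metis
    have "y \<in> game_level (Max (f ` fset G))" if "y \<in> fset G" for y
      using f[OF that] game_level_mono[of "f y" "Max (f ` fset G)"] that by auto
    then have "Game G g \<in> game_level (Suc (Max (f ` fset G)))" by auto
    then show ?case by blast
  qed
  then show ?thesis by auto
qed

datatype outcome = \<N> | \<P>

lemma game_option_size: "x |\<in>| G \<Longrightarrow> size x < size (Game G g)"
proof -
  assume "x |\<in>| G"
  then have "Suc (size x) \<le> (\<Sum>y\<in>fset G. Suc (size y))"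
    by (intro member_le_sum) auto
  then show ?thesis by simp
qed

function outcome_of :: "game \<Rightarrow> outcome" where
  "outcome_of (Game G g) = (if g \<and> (\<exists>G'\<in>fset G. outcome_of G' = \<P>) then \<N> else \<P>)"
  by pat_completeness auto
termination
  by (relation "measure size") (use game_option_size in auto)

function game_plus :: "game \<Rightarrow> game \<Rightarrow> game"  (infixl "+\<^sub>G" 65) where
  "Game G g +\<^sub>G Game H h =
     Game ((\<lambda>G'. G' +\<^sub>G Game H h) |`| G |\<union>| (\<lambda>H'. Game G g +\<^sub>G H') |`| H) (max g h)"
  by pat_completeness auto
termination
  by (relation "measure (\<lambda>(x, y). size x + size y)") (use game_option_size in auto)

definition game_eq :: "game \<Rightarrow> game \<Rightarrow> bool"  (infix "=\<^sub>G" 50) where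
  "G =\<^sub>G H \<longleftrightarrow> (\<forall>X. outcome_of (G +\<^sub>G X) = outcome_of (H +\<^sub>G X))"

function nim_heap :: "(nat \<Rightarrow> bool) \<Rightarrow> nat \<Rightarrow> game" where
  "nim_heap \<gamma> i = Game ((\<lambda>j. nim_heap \<gamma> j) |`| fset_of_list [0..<i]) (\<gamma> i)"
  by pat_completeness auto
termination
  by (relation "measure snd") (auto simp: fset_of_list.rep_eq)

declare nim_heap.simps [simp del]

end

theory Submission
  imports Defs
begin

text \<open>Put \<open>c = a \<oplus> b\<close>. By induction, the moves of \<open>\<ast>\<^sup>\<gamma>a + \<ast>\<^sup>0b\<close> lead, up to equality, to heaps
  \<open>\<ast>\<^sup>\<gamma>d\<close>; as in ordinary Nim, every \<open>d < c\<close> occurs and \<open>d = c\<close> does not. An extra move to some \<open>d > c\<close> is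
  reversible: if \<open>\<ast>\<^sup>\<gamma>d + X\<close> is active, then \<open>\<ast>\<^sup>\<gamma>c + X\<close> is one of its options. The position \<open>\<ast>\<^sup>\<gamma>d + X\<close>
  could only win by being inactive while \<open>\<ast>\<^sup>\<gamma>c + X\<close> is active, so that \<open>\<gamma>\<^sub>d \<noteq> \<gamma>\<^sub>c\<close>. But \<open>\<gamma>\<close> depends only
  on the bits from \<open>K\<close> upwards, which \<open>\<ast>\<^sup>0b\<close> does not touch, so this move lowers those bits of \<open>a\<close>,
  which forces \<open>d < c\<close>.\<close>

lemma nat_less_iff_div2:
  "(x :: nat) < y \<longleftrightarrow> x div 2 < y div 2 \<or> x div 2 = y div 2 \<and> even x \<and> odd y"
  by presburger

lemma xor_div_2: "((x :: nat) XOR y) div 2 = (x div 2) XOR (y div 2)"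
  using drop_bit_xor[of 1 x y] by (simp add: drop_bit_eq_div)

lemma even_xor_iff: "even ((x :: nat) XOR y) \<longleftrightarrow> (even x \<longleftrightarrow> even y)"
  using bit_xor_iff[of x y 0] by (auto simp: bit_0)

lemma xor_left_cancel_nat [simp]: "(x :: nat) XOR (x XOR y) = y"
  by (simp flip: xor.assoc)

lemma xor_right_cancel_nat [simp]: "((x :: nat) XOR y) XOR y = x"
  by (simp add: xor.assoc)

text \<open>This is the step of Nim that reaches every smaller value: a smaller \<open>c\<close>
  arises from lowering one of the two heaps. The induction strips the last bit of all three
  numbers.\<close>

lemma less_xor_cases:
  fixes a b c :: nat
  assumes "c < a XOR b"
  shows "c XOR b < a \<or> c XOR a < b"
  using assms
proof (induction c arbitrary: a b rule: measure_induct_rule[of "\<lambda>c. c"])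
  case (less c)
  \<comment> \<open>Halving gives a smaller number only for \<open>c > 0\<close>, so zero is treated
    apart.\<close>
  consider "c = 0" | "c > 0" "c div 2 < (a div 2) XOR (b div 2)"
    | "\<not> c div 2 < (a div 2) XOR (b div 2)" by blast
  then show ?case
  proof cases
    case 1
    then have "a \<noteq> b" using less.prems by auto
    then show ?thesis using 1 by auto
  next
    case 2
    then have "(c div 2) XOR (b div 2) < a div 2 \<or> (c div 2) XOR (a div 2) < b div 2"
      by (intro less.IH) simp_all
    then show ?thesis
      by (metis nat_less_iff_div2 xor_div_2)
  next
    case 3
    have "c div 2 < (a div 2) XOR (b div 2) \<or>
        c div 2 = (a div 2) XOR (b div 2) \<and> even c \<and> even a \<noteq> even b"
      using less.prems by (subst (asm) nat_less_iff_div2) (auto simp: xor_div_2 even_xor_iff)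
    then have eq: "c div 2 = (a div 2) XOR (b div 2)" and par: "even c" "even a \<noteq> even b"
      using 3 by auto
    \<comment> \<open>The last bit decides: exactly one of \<open>a\<close>, \<open>b\<close> is
      odd, and its replacement has the same half but is even.\<close>
    have "(c XOR b) div 2 = a div 2" "(c XOR a) div 2 = b div 2"
      using eq by (simp_all add: xor_div_2) (metis xor.commute xor_left_cancel_nat)
    moreover have "even (c XOR b) = even b" "even (c XOR a) = even a"
      using par by (simp_all add: even_xor_iff)
    ultimately show ?thesis
      using par nat_less_iff_div2[of "c XOR b" a] nat_less_iff_div2[of "c XOR a" b] by blast
  qed
qed

lemma xor_div_exp: "((x :: nat) XOR y) div 2 ^ K = (x div 2 ^ K) XOR (y div 2 ^ K)"
  using drop_bit_xor[of K x y] by (simp add: drop_bit_eq_div)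

lemma opts_game_plus:
  "fset (opts (G +\<^sub>G H)) = (\<lambda>G'. G' +\<^sub>G H) ` fset (opts G) \<union> (\<lambda>H'. G +\<^sub>G H') ` fset (opts H)"
  by (cases G; cases H) simp

lemma active_game_plus: "active (G +\<^sub>G H) \<longleftrightarrow> active G \<or> active H"
  by (cases G; cases H) (auto simp: max_def)

lemma opts_nim_heap: "fset (opts (nim_heap \<gamma> i)) = nim_heap \<gamma> ` {..<i}"
  by (subst nim_heap.simps) (auto simp: fset_of_list.rep_eq)

lemma active_nim_heap: "active (nim_heap \<gamma> i) = \<gamma> i"
  by (subst nim_heap.simps) simp

lemma outcome_P_iff:
  "outcome_of G = \<P> \<longleftrightarrow> \<not> (active G \<and> (\<exists>G'\<in>fset (opts G). outcome_of G' = \<P>))"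
  by (cases G) simp

lemma outcome_of_eqI: "(outcome_of G = \<P> \<longleftrightarrow> outcome_of H = \<P>) \<Longrightarrow> outcome_of G = outcome_of H"
  by (metis outcome.exhaust)

lemma size_opts_less: "X' \<in> fset (opts X) \<Longrightarrow> size X' < size X"
  by (cases X) (use game_option_size in auto)

lemma outcome_P_nim_heap_plus:
  "outcome_of (nim_heap \<gamma> c +\<^sub>G X) = \<P> \<longleftrightarrow> \<not> ((\<gamma> c \<or> active X) \<and>
    ((\<exists>d<c. outcome_of (nim_heap \<gamma> d +\<^sub>G X) = \<P>) \<or>
     (\<exists>X'\<in>fset (opts X). outcome_of (nim_heap \<gamma> c +\<^sub>G X') = \<P>)))"
  by (subst outcome_P_iff)
    (auto simp: opts_game_plus active_game_plus opts_nim_heap active_nim_heap)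

lemma outcome_P_nim_heaps_plus:
  "outcome_of (nim_heap \<gamma> a +\<^sub>G nim_heap \<delta> b +\<^sub>G X) = \<P> \<longleftrightarrow> \<not> ((\<gamma> a \<or> \<delta> b \<or> active X) \<and>
    ((\<exists>a'<a. outcome_of (nim_heap \<gamma> a' +\<^sub>G nim_heap \<delta> b +\<^sub>G X) = \<P>) \<or>
     (\<exists>b'<b. outcome_of (nim_heap \<gamma> a +\<^sub>G nim_heap \<delta> b' +\<^sub>G X) = \<P>) \<or>
     (\<exists>X'\<in>fset (opts X). outcome_of (nim_heap \<gamma> a +\<^sub>G nim_heap \<delta> b +\<^sub>G X') = \<P>)))"
  by (subst outcome_P_iff)
    (auto simp: opts_game_plus active_game_plus opts_nim_heap active_nim_heap)

text \<open>The arbitrary summand \<open>X\<close> is the test game of \<open>=\<^sub>G\<close>.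
  Since a move may occur in either heap or in \<open>X\<close>, the induction runs on
  \<open>a + b + size X\<close>.\<close>

lemma outcome_nim_heaps_plus:
  fixes \<gamma> :: "nat \<Rightarrow> bool"
  assumes \<gamma>: "\<And>i j :: nat. j < 2 ^ K \<Longrightarrow> \<gamma> i = \<gamma> (i XOR j)"
    and "b < 2 ^ K"
  shows "outcome_of (nim_heap \<gamma> a +\<^sub>G nim_heap (\<lambda>_. False) b +\<^sub>G X) =
    outcome_of (nim_heap \<gamma> (a XOR b) +\<^sub>G X)"
  using \<open>b < 2 ^ K\<close>
proof (induction "a + b + size X" arbitrary: a b X rule: less_induct)
  case less
  define c where "c = a XOR b"
  define win where "win d \<longleftrightarrow> outcome_of (nim_heap \<gamma> d +\<^sub>G X) = \<P>" for d
  \<comment> \<open>These are the heap sizes to which the induction hypothesis reduces the moves in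
    the two heaps.\<close>
  define moves where "moves = (\<lambda>a'. a' XOR b) ` {..<a} \<union> (\<lambda>b'. a XOR b') ` {..<b}"
  have \<gamma>c: "\<gamma> c = \<gamma> a"
    using \<gamma>[OF less.prems] by (simp add: c_def)
  have moves_less: "d \<in> moves" if "d < c" for d
    using less_xor_cases[of d a b] that unfolding c_def moves_def
    by (metis UnI1 UnI2 image_eqI lessThan_iff xor.commute xor_left_cancel_nat)
  have c_notin: "c \<notin> moves"
    unfolding c_def moves_def by (auto; metis less_irrefl xor_left_cancel_nat xor_right_cancel_nat)
  have \<gamma>_moves: "\<gamma> d = \<gamma> c" if "d \<in> moves" "c < d" for d
    using that(1) unfolding moves_def
  proof
    assume "d \<in> (\<lambda>a'. a' XOR b) ` {..<a}"
    then obtain a' where a': "a' < a" "d = a' XOR b" by auto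
    \<comment> \<open>Dividing by \<open>2 ^ K\<close> erases \<open>b\<close>, so
      \<open>c < d\<close> bounds the quotient of \<open>a\<close> by that of \<open>a'\<close>,
      while \<open>a' < a\<close> gives the converse. Hence \<open>a\<close> and \<open>a'\<close>
      differ only in the low \<open>K\<close> bits.\<close>
    have "c div 2 ^ K \<le> d div 2 ^ K"
      using \<open>c < d\<close> by (simp add: div_le_mono)
    then have "a div 2 ^ K \<le> a' div 2 ^ K"
      using less.prems by (simp add: c_def a' xor_div_exp)
    then have "a div 2 ^ K = a' div 2 ^ K"
      using a' by (simp add: div_le_mono order_antisym)
    then have "(a XOR a') div 2 ^ K = 0"
      by (simp add: xor_div_exp)
    then have "a XOR a' < 2 ^ K"
      by (simp add: div_eq_0_iff)
    then have "\<gamma> a = \<gamma> a'"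
      using \<gamma>[of "a XOR a'" a] by simp
    then show ?thesis
      using \<gamma>[OF less.prems, of a'] by (simp add: \<gamma>c a')
  next
    assume "d \<in> (\<lambda>b'. a XOR b') ` {..<b}"
    then obtain b' where "b' < b" "d = a XOR b'" by auto
    then show ?thesis
      using \<gamma>[of b' a] less.prems by (simp add: \<gamma>c)
  qed
  have IH_a: "outcome_of (nim_heap \<gamma> a' +\<^sub>G nim_heap (\<lambda>_. False) b +\<^sub>G X) = \<P> \<longleftrightarrow> win (a' XOR b)"
    if "a' < a" for a'
    using less.hyps[of a' b X] less.prems that by (simp add: win_def)
  have IH_b: "outcome_of (nim_heap \<gamma> a +\<^sub>G nim_heap (\<lambda>_. False) b' +\<^sub>G X) = \<P> \<longleftrightarrow> win (a XOR b')"
    if "b' < b" for b'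
    using less.hyps[of a b' X] less.prems that by (simp add: win_def)
  have IH_X: "outcome_of (nim_heap \<gamma> a +\<^sub>G nim_heap (\<lambda>_. False) b +\<^sub>G X') =
      outcome_of (nim_heap \<gamma> c +\<^sub>G X')"
    if "X' \<in> fset (opts X)" for X'
    using less.hyps[of a b X'] less.prems size_opts_less[OF that] by (simp add: c_def)
  define winX where "winX \<longleftrightarrow> (\<exists>X'\<in>fset (opts X). outcome_of (nim_heap \<gamma> c +\<^sub>G X') = \<P>)"
  have left: "outcome_of (nim_heap \<gamma> a +\<^sub>G nim_heap (\<lambda>_. False) b +\<^sub>G X) = \<P> \<longleftrightarrow>
      \<not> ((\<gamma> c \<or> active X) \<and> ((\<exists>d\<in>moves. win d) \<or> winX))"
    using IH_a IH_b IH_X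
    by (subst outcome_P_nim_heaps_plus) (auto simp: moves_def winX_def \<gamma>c)
  have right: "win c \<longleftrightarrow> \<not> ((\<gamma> c \<or> active X) \<and> ((\<exists>d<c. win d) \<or> winX))"
    unfolding win_def winX_def by (rule outcome_P_nim_heap_plus)
  \<comment> \<open>As \<open>\<gamma> d = \<gamma> c\<close>, the position at \<open>d\<close> is
    active too; having outcome \<open>\<P>\<close>, it has no option of outcome \<open>\<P>\<close>,
    and the position at \<open>c\<close> is one of its options.\<close>
  have rev: "\<not> win c" if "d \<in> moves" "win d" "c < d" "\<gamma> c \<or> active X" for d
    using that \<gamma>_moves[of d] outcome_P_nim_heap_plus[of \<gamma> d X] by (auto simp: win_def)
  \<comment> \<open>If the position is inactive, both sides hold. Otherwise only a winning
    \<open>d > c\<close> in \<open>moves\<close> could separate \<open>left\<close> from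
    \<open>right\<close>, and then \<open>rev\<close> makes both sides false.\<close>
  have "win c \<longleftrightarrow> outcome_of (nim_heap \<gamma> a +\<^sub>G nim_heap (\<lambda>_. False) b +\<^sub>G X) = \<P>"
    using left right rev moves_less c_notin by (metis linorder_neqE_nat)
  then show ?case
    by (intro outcome_of_eqI) (simp add: win_def c_def)
qed

theorem theorem3p53:
  fixes \<gamma> :: "nat \<Rightarrow> bool" and K :: nat
  assumes "\<And>i j :: nat. j < 2 ^ K \<Longrightarrow> \<gamma> i = \<gamma> (i XOR j)"
  shows "\<forall>a b :: nat. b < 2 ^ K \<longrightarrow>
    nim_heap \<gamma> a +\<^sub>G nim_heap (\<lambda>_. False) b =\<^sub>G nim_heap \<gamma> (a XOR b)"
  unfolding game_eq_def using outcome_nim_heaps_plus[OF assms] by blast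

end
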